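(* Let $P$ be a finite poset with an element $s\in P$ such that (i) for all $a\in P$, $a\vee s$ exists or $a\wedge s$ exists in $P$; and (ii) for all $a,b\in P$, if $a>b$, $a\vee s$ does not exist and $b\vee s$ does exist, then $a\wedge(b\vee s)$ exists in $P$. Then the order complex $\Delta(P)$ is non-evasive.
   Context: A simplicial complex is a down-set $\Sigma$ of a power set of a set (the empty set $\emptyset$ is allowed to be a member). Its vertex set is $V(\Sigma)=\{x\mid \{x\}\in\Sigma\}$. For $W\subseteq V$, $\Sigma|W=\{\sigma\in\Sigma\mid \sigma\subseteq W\}$. For $\sigma\in\Sigma$: $\mathrm{dl}_\Sigma(\sigma)=\Sigma|(V\setminus\sigma)$, $\mathrm{st}_\Sigma(\sigma)=\{\tau\in\Sigma\mid \sigma\cup\tau\in\Sigma\}$, $\mathrm{lk}_\Sigma(\sigma)=\mathrm{dl}_\Sigma(\sigma)\cap\mathrm{st}_\Sigma(\sigma)$; for a vertex $v$ write $\mathrm{dl}_\Sigma(v)$, $\mathrm{lk}_\Sigma(v)$ for $\sigma=\{v\}$. Non-evasiveness is defined by induction on $|V|$ (for $V$ finite): $\Sigma$ is non-evasive if for some $v\in V$, either $\Sigma=\{\emptyset,\{v\}\}$, or $|V|>1$ and both $\mathrm{dl}_\Sigma(v)$ and $\mathrm{lk}_\Sigma(v)$ are non-evasive. The order complex $\Delta(P)$ of a poset $P$ is the simplicial complex of all chains of $P$ (including $\emptyset$). *)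

theory Defs
  imports "HOL-Algebra.Lattice"
begin

definition simplicial_complex :: "'a set set \<Rightarrow> bool" where
  "simplicial_complex K \<longleftrightarrow> (\<forall>\<sigma>\<in>K. \<forall>\<tau>. \<tau> \<subseteq> \<sigma> \<longrightarrow> \<tau> \<in> K)"

definition vertices :: "'a set set \<Rightarrow> 'a set" where
  "vertices K = {x. {x} \<in> K}"

definition restriction :: "'a set set \<Rightarrow> 'a set \<Rightarrow> 'a set set" where
  "restriction K W = {\<sigma> \<in> K. \<sigma> \<subseteq> W}"

definition dl :: "'a set set \<Rightarrow> 'a set \<Rightarrow> 'a set set" where
  "dl K \<sigma> = restriction K (vertices K - \<sigma>)"

definition st :: "'a set set \<Rightarrow> 'a set \<Rightarrow> 'a set set" where
  "st K \<sigma> = {\<tau> \<in> K. \<sigma> \<union> \<tau> \<in> K}"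

definition lk :: "'a set set \<Rightarrow> 'a set \<Rightarrow> 'a set set" where
  "lk K \<sigma> = dl K \<sigma> \<inter> st K \<sigma>"

text \<open>
  The recursion on the number of vertices is rendered as a least fixed point. Deleting a vertex
  and passing to its link both decrease the number of vertices, so this is the unique predicate
  satisfying the recursion; see \<open>nonevasive_iff\<close> and \<open>card_vertices_dl_lk\<close> below.
\<close>

inductive nonevasive :: "'a set set \<Rightarrow> bool" where
  point: "nonevasive {{}, {v}}"
| step: "\<lbrakk>simplicial_complex K; finite (vertices K); card (vertices K) > 1; v \<in> vertices K;
          nonevasive (dl K {v}); nonevasive (lk K {v})\<rbrakk> \<Longrightarrow> nonevasive K"

definition order_complex :: "('a, 'm) gorder_scheme \<Rightarrow> 'a set set" where
  "order_complex P =
     {C. C \<subseteq> carrier P \<and> (\<forall>x\<in>C. \<forall>y\<in>C. x \<sqsubseteq>\<^bsub>P\<^esub> y \<or> y \<sqsubseteq>\<^bsub>P\<^esub> x)}"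

text \<open>
  \<open>join P x y\<close> and \<open>meet P x y\<close> are chosen by \<open>SOME\<close> and are therefore meaningful only under the
  following conditions.
\<close>

definition join_exists :: "('a, 'm) gorder_scheme \<Rightarrow> 'a \<Rightarrow> 'a \<Rightarrow> bool" where
  "join_exists P x y \<longleftrightarrow> (\<exists>j. least P j (Upper P {x, y}))"

definition meet_exists :: "('a, 'm) gorder_scheme \<Rightarrow> 'a \<Rightarrow> 'a \<Rightarrow> bool" where
  "meet_exists P x y \<longleftrightarrow> (\<exists>m. greatest P m (Lower P {x, y}))"

lemma simplicial_complex_dl: "simplicial_complex K \<Longrightarrow> simplicial_complex (dl K \<sigma>)"
  unfolding simplicial_complex_def dl_def restriction_def by blast

lemma simplicial_complex_lk:
  assumes "simplicial_complex K"
  shows "simplicial_complex (lk K \<sigma>)"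
  unfolding simplicial_complex_def
proof (intro ballI allI impI)
  fix \<rho> \<tau> assume h: "\<rho> \<in> lk K \<sigma>" "\<tau> \<subseteq> \<rho>"
  then have "\<sigma> \<union> \<tau> \<subseteq> \<sigma> \<union> \<rho>" "\<sigma> \<union> \<rho> \<in> K" "\<rho> \<in> K" "\<rho> \<subseteq> vertices K - \<sigma>"
    by (auto simp: lk_def dl_def st_def restriction_def)
  then show "\<tau> \<in> lk K \<sigma>"
    using assms h(2) unfolding simplicial_complex_def lk_def dl_def st_def restriction_def by blast
qed

lemma card_vertices_dl_lk:
  assumes "finite (vertices K)" "v \<in> vertices K"
  shows "card (vertices (dl K {v})) < card (vertices K)"
    and "card (vertices (lk K {v})) < card (vertices K)"
  using assms
  by (auto intro!: psubset_card_mono simp: vertices_def lk_def dl_def restriction_def)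

lemma nonevasive_simplicial_complex: "nonevasive K \<Longrightarrow> simplicial_complex K"
  by (induction rule: nonevasive.induct) (auto simp: simplicial_complex_def)

lemma nonevasive_iff:
  assumes "simplicial_complex K" "finite (vertices K)"
  shows "nonevasive K \<longleftrightarrow>
    (\<exists>v\<in>vertices K. K = {{}, {v}} \<or>
       card (vertices K) > 1 \<and> nonevasive (dl K {v}) \<and> nonevasive (lk K {v}))"
proof
  assume "nonevasive K"
  then show "\<exists>v\<in>vertices K. K = {{}, {v}} \<or>
       card (vertices K) > 1 \<and> nonevasive (dl K {v}) \<and> nonevasive (lk K {v})"
    by cases (auto simp: vertices_def)
next
  assume "\<exists>v\<in>vertices K. K = {{}, {v}} \<or>
       card (vertices K) > 1 \<and> nonevasive (dl K {v}) \<and> nonevasive (lk K {v})"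
  then show "nonevasive K"
    using assms by (auto intro: nonevasive.intros)
qed

lemma simplicial_complex_order_complex: "simplicial_complex (order_complex P)"
  unfolding simplicial_complex_def order_complex_def by blast

lemma vertices_order_complex:
  assumes "partial_order P"
  shows "vertices (order_complex P) = carrier P"
proof -
  interpret partial_order P by fact
  show ?thesis by (auto simp: vertices_def order_complex_def)
qed

end

theory Submission
  imports Defs
begin

text \<open>
  Let \<open>J\<close> be the set of all \<open>a\<close> such that \<open>a \<or> s\<close> exists. A finite poset with a closure operator
  whose image has a least element is non-evasive: delete the non-closed elements from the top
  downwards, the link of \<open>b\<close> being a cone whose apex is the closure of \<open>b\<close>. So \<open>J\<close> is non-evasive,
  via the closure operator \<open>x \<mapsto> x \<or> s\<close> with least closed element \<open>s\<close>. An element \<open>a\<close> outside \<open>J\<close>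
  that is minimal among those still present has exactly \<open>J\<^sub><\<^sub>a\<close> below it, and \<open>J\<^sub><\<^sub>a\<close> is non-evasive via
  the closure operator \<open>x \<mapsto> a \<and> (x \<or> s)\<close> with least closed element \<open>a \<and> s\<close>. Here hypothesis (ii)
  enters, and \<open>a \<and> (x \<or> s) \<noteq> a\<close> because otherwise \<open>x \<or> s\<close> would be a join of \<open>a\<close> and \<open>s\<close>. Hence the
  link of \<open>a\<close>, a join with a non-evasive factor, is non-evasive, and \<open>a\<close> may be deleted.
\<close>

section \<open>Non-evasive complexes\<close>

lemma vertices_dl [simp]: "vertices (dl K \<sigma>) = vertices K - \<sigma>"
  by (auto simp: vertices_def dl_def restriction_def)

lemma vertices_lk_subset: "vertices (lk K \<sigma>) \<subseteq> vertices K - \<sigma>"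
  by (auto simp: vertices_def lk_def dl_def restriction_def)

lemma simplicial_complex_subset_vertices:
  assumes "simplicial_complex K" "\<sigma> \<in> K"
  shows "\<sigma> \<subseteq> vertices K"
  using assms unfolding simplicial_complex_def vertices_def by blast

lemma dl_iff:
  assumes "simplicial_complex K"
  shows "\<sigma> \<in> dl K {v} \<longleftrightarrow> \<sigma> \<in> K \<and> v \<notin> \<sigma>"
  using simplicial_complex_subset_vertices[OF assms] unfolding dl_def restriction_def by blast

lemma lk_iff:
  assumes "simplicial_complex K"
  shows "\<sigma> \<in> lk K {v} \<longleftrightarrow> insert v \<sigma> \<in> K \<and> v \<notin> \<sigma>"
proof -
  have "insert v \<sigma> \<in> K \<Longrightarrow> \<sigma> \<in> K"
    using assms unfolding simplicial_complex_def by blast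
  then show ?thesis
    using dl_iff[OF assms] unfolding lk_def st_def by auto
qed

lemma nonevasive_vertices_nonempty: "nonevasive K \<Longrightarrow> vertices K \<noteq> {}"
  by (induction rule: nonevasive.induct) (auto simp: vertices_def)

text \<open>The cardinality condition of rule \<open>step\<close> is automatic: a non-evasive
  deletion has a vertex, and \<open>v\<close> is a further one.\<close>

lemma nonevasive_stepI:
  assumes "simplicial_complex K" "finite (vertices K)" "v \<in> vertices K"
    and "nonevasive (dl K {v})" "nonevasive (lk K {v})"
  shows "nonevasive K"
proof (rule nonevasive.step[OF assms(1,2) _ assms(3-5)])
  have "0 < card (vertices (dl K {v}))"
    using nonevasive_vertices_nonempty[OF assms(4)] assms(2) by (simp add: card_gt_0_iff)
  then show "1 < card (vertices K)"
    using card_vertices_dl_lk(1)[OF assms(2,3)] by linarith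
qed

text \<open>Any vertex \<open>w\<close> other than the apex can be removed, because its deletion and
  its link are again cones with apex \<open>v\<close>. Induction on the number of vertices ends at
  the single point \<open>v\<close>.\<close>

lemma nonevasive_cone:
  assumes "simplicial_complex K" "finite (vertices K)" "v \<in> vertices K"
    and "\<And>\<sigma>. \<sigma> \<in> K \<Longrightarrow> insert v \<sigma> \<in> K"
  shows "nonevasive K"
  using assms
proof (induction "card (vertices K)" arbitrary: K rule: less_induct)
  case less
  note K = less.prems
  show ?case
  proof (cases "vertices K = {v}")
    case True
    have "K \<subseteq> {{}, {v}}"
      using simplicial_complex_subset_vertices[OF K(1)] True by (auto dest: subset_singletonD)
    moreover have "{v} \<in> K" using K(3) by (simp add: vertices_def)
    moreover have "{} \<in> K" using \<open>{v} \<in> K\<close> K(1) unfolding simplicial_complex_def by blast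
    ultimately have "K = {{}, {v}}" by auto
    then show ?thesis by (simp add: nonevasive.point)
  next
    case False
    then obtain w where w: "w \<in> vertices K" "w \<noteq> v" using K(3) by blast
    have "{w} \<in> K" using w by (simp add: vertices_def)
    have "nonevasive (dl K {w})"
    proof (rule less.hyps)
      show "card (vertices (dl K {w})) < card (vertices K)"
        by (rule card_vertices_dl_lk(1)[OF K(2) w(1)])
      show "simplicial_complex (dl K {w})" by (rule simplicial_complex_dl[OF K(1)])
      show "finite (vertices (dl K {w}))" "v \<in> vertices (dl K {w})" using K w by auto
      show "insert v \<sigma> \<in> dl K {w}" if "\<sigma> \<in> dl K {w}" for \<sigma>
        using that K(4) w(2) by (auto simp: dl_iff[OF K(1)])
    qed
    moreover have "nonevasive (lk K {w})"
    proof (rule less.hyps)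
      show "card (vertices (lk K {w})) < card (vertices K)"
        by (rule card_vertices_dl_lk(2)[OF K(2) w(1)])
      show "simplicial_complex (lk K {w})" by (rule simplicial_complex_lk[OF K(1)])
      show "finite (vertices (lk K {w}))"
        by (rule finite_subset[OF vertices_lk_subset]) (simp add: K)
      \<comment> \<open>Coning the face \<open>{w}\<close> gives the edge \<open>{v, w}\<close>, so
        the apex survives in the link.\<close>
      show "v \<in> vertices (lk K {w})"
        using K(4)[OF \<open>{w} \<in> K\<close>] w(2)
        by (simp add: vertices_def lk_iff[OF K(1)] insert_commute)
      show "insert v \<sigma> \<in> lk K {w}" if "\<sigma> \<in> lk K {w}" for \<sigma>
        using that K(4)[of "insert w \<sigma>"] w(2) by (auto simp: lk_iff[OF K(1)] insert_commute)
    qed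
    ultimately show ?thesis by (rule nonevasive_stepI[OF K(1,2) w(1)])
  qed
qed

text \<open>Plain unions are used instead of a disjoint sum of vertex types, so this is the
  simplicial join when the vertex sets are disjoint; disjointness is stated where it
  matters.\<close>

definition join_complex :: "'a set set \<Rightarrow> 'a set set \<Rightarrow> 'a set set" where
  "join_complex K L = {\<sigma> \<union> \<tau> |\<sigma> \<tau>. \<sigma> \<in> K \<and> \<tau> \<in> L}"

lemma join_complex_iff: "\<rho> \<in> join_complex K L \<longleftrightarrow> (\<exists>\<sigma>\<in>K. \<exists>\<tau>\<in>L. \<rho> = \<sigma> \<union> \<tau>)"
  unfolding join_complex_def by blast

lemma simplicial_complex_join_complex:
  assumes "simplicial_complex K" "simplicial_complex L"
  shows "simplicial_complex (join_complex K L)"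
  unfolding simplicial_complex_def
proof (intro ballI allI impI)
  fix \<rho> \<rho>' assume "\<rho> \<in> join_complex K L" and sub: "\<rho>' \<subseteq> \<rho>"
  then obtain \<sigma> \<tau> where \<rho>: "\<rho> = \<sigma> \<union> \<tau>" "\<sigma> \<in> K" "\<tau> \<in> L" unfolding join_complex_iff by blast
  have "\<rho>' \<inter> \<sigma> \<in> K" "\<rho>' \<inter> \<tau> \<in> L"
    using \<rho>(2,3) assms unfolding simplicial_complex_def by (meson Int_lower2)+
  moreover have "\<rho>' = (\<rho>' \<inter> \<sigma>) \<union> (\<rho>' \<inter> \<tau>)" using sub \<rho>(1) by blast
  ultimately show "\<rho>' \<in> join_complex K L" unfolding join_complex_iff by blast
qed

lemma vertices_join_complex:
  assumes "simplicial_complex K" "simplicial_complex L" "{} \<in> K" "{} \<in> L"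
  shows "vertices (join_complex K L) = vertices K \<union> vertices L"
proof
  have "\<sigma> \<in> join_complex K L" if "\<sigma> \<in> K" for \<sigma>
    unfolding join_complex_iff using that assms(4) by (metis Un_empty_right)
  moreover have "\<tau> \<in> join_complex K L" if "\<tau> \<in> L" for \<tau>
    unfolding join_complex_iff using that assms(3) by (metis Un_empty_left)
  ultimately show "vertices K \<union> vertices L \<subseteq> vertices (join_complex K L)"
    unfolding vertices_def by blast
  show "vertices (join_complex K L) \<subseteq> vertices K \<union> vertices L"
  proof
    fix x assume "x \<in> vertices (join_complex K L)"
    then obtain \<sigma> \<tau> where "{x} = \<sigma> \<union> \<tau>" "\<sigma> \<in> K" "\<tau> \<in> L"
      unfolding vertices_def join_complex_iff by auto
    moreover from this have "x \<in> \<sigma> \<or> x \<in> \<tau>" by blast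
    ultimately show "x \<in> vertices K \<union> vertices L"
      using simplicial_complex_subset_vertices[OF assms(1)]
        simplicial_complex_subset_vertices[OF assms(2)] by blast
  qed
qed

lemma dl_join_complex:
  assumes "simplicial_complex K" "simplicial_complex L" "v \<notin> vertices L"
  shows "dl (join_complex K L) {v} = join_complex (dl K {v}) L"
proof -
  have "v \<notin> \<tau>" if "\<tau> \<in> L" for \<tau>
    using simplicial_complex_subset_vertices[OF assms(2) that] assms(3) by blast
  then show ?thesis
    unfolding set_eq_iff dl_iff[OF simplicial_complex_join_complex[OF assms(1,2)]]
    by (auto simp: join_complex_iff dl_iff[OF assms(1)])
qed

text \<open>In a face \<open>\<sigma> \<union> \<tau>\<close> containing \<open>v\<close>, the
  vertex can only come from \<open>\<sigma>\<close>; removing it there leaves the factor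
  \<open>L\<close> untouched.\<close>

lemma lk_join_complex:
  assumes "simplicial_complex K" "simplicial_complex L" "v \<notin> vertices L"
  shows "lk (join_complex K L) {v} = join_complex (lk K {v}) L"
proof (rule Set.set_eqI)
  fix \<rho>
  have vL: "v \<notin> \<tau>" if "\<tau> \<in> L" for \<tau>
    using simplicial_complex_subset_vertices[OF assms(2) that] assms(3) by blast
  note lkJ = lk_iff[OF simplicial_complex_join_complex[OF assms(1,2)]]
  show "\<rho> \<in> lk (join_complex K L) {v} \<longleftrightarrow> \<rho> \<in> join_complex (lk K {v}) L"
  proof
    assume "\<rho> \<in> lk (join_complex K L) {v}"
    then obtain \<sigma> \<tau> where 1: "insert v \<rho> = \<sigma> \<union> \<tau>" "\<sigma> \<in> K" "\<tau> \<in> L" "v \<notin> \<rho>"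
      unfolding lkJ join_complex_iff by blast
    have "v \<notin> \<tau>" using vL 1(3) .
    moreover have "v \<in> \<sigma> \<union> \<tau>" using 1(1) by (metis insertI1)
    ultimately have "v \<in> \<sigma>" "v \<notin> \<tau>" by auto
    then have "\<sigma> - {v} \<in> lk K {v}" "\<rho> = (\<sigma> - {v}) \<union> \<tau>"
      using 1 by (auto simp: lk_iff[OF assms(1)] insert_absorb)
    then show "\<rho> \<in> join_complex (lk K {v}) L" using 1(3) unfolding join_complex_iff by blast
  next
    assume "\<rho> \<in> join_complex (lk K {v}) L"
    then obtain \<sigma> \<tau> where 1: "\<rho> = \<sigma> \<union> \<tau>" "\<sigma> \<in> lk K {v}" "\<tau> \<in> L"
      unfolding join_complex_iff by blast
    then have "insert v \<sigma> \<in> K" "insert v \<rho> = insert v \<sigma> \<union> \<tau>" "v \<notin> \<rho>"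
      using vL by (auto simp: lk_iff[OF assms(1)])
    then show "\<rho> \<in> lk (join_complex K L) {v}"
      unfolding lkJ join_complex_iff using 1(3) by blast
  qed
qed

lemma nonevasive_empty_mem: "nonevasive K \<Longrightarrow> {} \<in> K"
  by (induction rule: nonevasive.induct) (auto simp: dl_def restriction_def)

text \<open>Induction on the derivation for \<open>K\<close>: a point joined with \<open>L\<close>
  is a cone, and deleting or linking a vertex of \<open>K\<close> commutes with joining
  \<open>L\<close>. The factor \<open>L\<close> may be any complex on finitely many vertices that
  contains the empty face, even \<open>{{}}\<close>.\<close>

lemma nonevasive_join_complex:
  assumes "nonevasive K"
    and "simplicial_complex L" "{} \<in> L" "finite (vertices L)" "vertices K \<inter> vertices L = {}"
  shows "nonevasive (join_complex K L)"
  using assms(1,5)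
proof (induction rule: nonevasive.induct)
  case (point v)
  have sc: "simplicial_complex {{}, {v}}"
    using nonevasive.point by (rule nonevasive_simplicial_complex)
  show ?case
  proof (rule nonevasive_cone[where v = v])
    have "vertices {{}, {v}} = {v}" by (auto simp: vertices_def)
    then show "finite (vertices (join_complex {{}, {v}} L))"
      and "v \<in> vertices (join_complex {{}, {v}} L)"
      using assms(4) by (simp_all add: vertices_join_complex[OF sc assms(2) _ assms(3)])
    show "simplicial_complex (join_complex {{}, {v}} L)"
      by (rule simplicial_complex_join_complex[OF sc assms(2)])
    show "insert v \<sigma> \<in> join_complex {{}, {v}} L" if \<sigma>: "\<sigma> \<in> join_complex {{}, {v}} L" for \<sigma>
    proof -
      obtain \<rho> \<tau> where "\<rho> \<in> {{}, {v}}" "\<tau> \<in> L" "\<sigma> = \<rho> \<union> \<tau>"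
        using \<sigma> unfolding join_complex_iff by blast
      then have "insert v \<sigma> = {v} \<union> \<tau>" by auto
      then show ?thesis using \<open>\<tau> \<in> L\<close> by (metis join_complex_iff insertI1 insertI2)
    qed
  qed
next
  case (step K v)
  \<comment> \<open>Reassembled from the premises of the rule in order to obtain
    \<open>{} \<in> K\<close>, which the formula for the vertices of a join requires.\<close>
  have "nonevasive K" by (rule nonevasive.step) (use step in auto)
  then have "{} \<in> K" by (rule nonevasive_empty_mem)
  note vert = vertices_join_complex[OF step.hyps(1) assms(2) this assms(3)]
  have v: "v \<notin> vertices L" using step by blast
  show ?case
  proof (rule nonevasive_stepI[where v = v])
    show "simplicial_complex (join_complex K L)"
      by (rule simplicial_complex_join_complex[OF step.hyps(1) assms(2)])
    show "finite (vertices (join_complex K L))" "v \<in> vertices (join_complex K L)"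
      using step.hyps assms(4) by (simp_all add: vert)
    have "vertices (dl K {v}) \<inter> vertices L = {}" using step.prems by auto
    then show "nonevasive (dl (join_complex K L) {v})"
      using step.IH(1) by (simp add: dl_join_complex[OF step.hyps(1) assms(2) v])
    have "vertices (lk K {v}) \<subseteq> vertices K"
      by (rule order_trans[OF vertices_lk_subset Diff_subset])
    then have "vertices (lk K {v}) \<inter> vertices L = {}" using step.prems by blast
    then show "nonevasive (lk (join_complex K L) {v})"
      using step.IH(2) by (simp add: lk_join_complex[OF step.hyps(1) assms(2) v])
  qed
qed

section \<open>Order complexes of finite posets\<close>

context partial_order
begin

section \<open>Order complexes of subposets, kept as restrictions of one ambient complex\<close>

abbreviation chains_in :: "'a set \<Rightarrow> 'a set set" where
  "chains_in A \<equiv> restriction (order_complex L) A"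

lemma chains_in_iff:
  assumes "A \<subseteq> carrier L"
  shows "C \<in> chains_in A \<longleftrightarrow> C \<subseteq> A \<and> (\<forall>x\<in>C. \<forall>y\<in>C. x \<sqsubseteq> y \<or> y \<sqsubseteq> x)"
  using assms by (auto simp: restriction_def order_complex_def)

lemma simplicial_complex_chains_in: "simplicial_complex (chains_in A)"
  using simplicial_complex_order_complex[of L]
  unfolding simplicial_complex_def restriction_def by blast

lemma vertices_chains_in: "A \<subseteq> carrier L \<Longrightarrow> vertices (chains_in A) = A"
  by (auto simp: vertices_def chains_in_iff)

lemma dl_chains_in: "dl (chains_in A) {v} = chains_in (A - {v})"
  unfolding set_eq_iff dl_iff[OF simplicial_complex_chains_in] by (auto simp: restriction_def)

text \<open>The order lives on a carrier and not on a type class, so the extremal element comes from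
  the general fact about asymmetric transitive relations on a finite set.\<close>

lemma finite_has_maximal_in:
  assumes "finite A" "A \<noteq> {}" "A \<subseteq> carrier L"
  obtains m where "m \<in> A" "\<And>x. x \<in> A \<Longrightarrow> m \<sqsubseteq> x \<Longrightarrow> x = m"
proof -
  have "\<exists>m\<in>A. \<forall>x\<in>A. x \<noteq> m \<longrightarrow> \<not> m \<sqsubset> x"
  proof (rule Finite_Set.bex_max_element[OF assms(1)])
    show "asymp_on A (\<sqsubset>)" using assms(3) le_antisym unfolding lless_eq by (intro asymp_onI) blast
    show "transp_on A (\<sqsubset>)"
      using assms(3) by (intro transp_onI) (meson lless_trans subsetD)
  qed (rule assms)
  then show thesis using that by (auto simp: lless_eq)
qed

lemma finite_has_minimal_in:
  assumes "finite A" "A \<noteq> {}" "A \<subseteq> carrier L"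
  obtains m where "m \<in> A" "\<And>x. x \<in> A \<Longrightarrow> x \<sqsubseteq> m \<Longrightarrow> x = m"
proof -
  have "\<exists>m\<in>A. \<forall>x\<in>A. x \<noteq> m \<longrightarrow> \<not> x \<sqsubset> m"
  proof (rule Finite_Set.bex_min_element[OF assms(1)])
    show "asymp_on A (\<sqsubset>)" using assms(3) le_antisym unfolding lless_eq by (intro asymp_onI) blast
    show "transp_on A (\<sqsubset>)"
      using assms(3) by (intro transp_onI) (meson lless_trans subsetD)
  qed (rule assms)
  then show thesis using that by (auto simp: lless_eq)
qed

lemma nonevasive_delete:
  assumes "finite A" "A \<subseteq> carrier L" "v \<in> A"
    and "nonevasive (chains_in (A - {v}))" "nonevasive (lk (chains_in A) {v})"
  shows "nonevasive (chains_in A)"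
  by (rule nonevasive_stepI[where v = v])
    (use assms in \<open>simp_all add: simplicial_complex_chains_in vertices_chains_in dl_chains_in\<close>)

text \<open>A chain through \<open>v\<close> splits into its parts below and above \<open>v\<close>;
  conversely, transitivity through \<open>v\<close> makes the union of two such chains a
  chain.\<close>

lemma lk_chains_in:
  assumes "A \<subseteq> carrier L" "v \<in> A"
  shows "lk (chains_in A) {v} = join_complex (chains_in {x \<in> A. x \<sqsubset> v}) (chains_in {x \<in> A. v \<sqsubset> x})"
    (is "_ = join_complex (chains_in ?B) (chains_in ?U)")
proof (rule Set.set_eqI)
  fix C
  have BU: "?B \<subseteq> carrier L" "?U \<subseteq> carrier L" using assms(1) by auto
  note iffs = lk_iff[OF simplicial_complex_chains_in] chains_in_iff[OF assms(1)]
    chains_in_iff[OF BU(1)] chains_in_iff[OF BU(2)]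
  show "C \<in> lk (chains_in A) {v} \<longleftrightarrow> C \<in> join_complex (chains_in ?B) (chains_in ?U)"
  proof
    assume C: "C \<in> lk (chains_in A) {v}"
    have "C = (C \<inter> ?B) \<union> (C \<inter> ?U)" using C unfolding iffs by (auto simp: lless_eq)
    moreover have "C \<inter> ?B \<in> chains_in ?B" "C \<inter> ?U \<in> chains_in ?U"
      using C unfolding iffs by auto
    ultimately show "C \<in> join_complex (chains_in ?B) (chains_in ?U)"
      unfolding join_complex_iff by blast
  next
    assume "C \<in> join_complex (chains_in ?B) (chains_in ?U)"
    then obtain S T where C: "C = S \<union> T" and S: "S \<in> chains_in ?B" and T: "T \<in> chains_in ?U"
      unfolding join_complex_iff by blast
    have "x \<sqsubseteq> y" if "x \<in> S" "y \<in> T" for x y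
    proof (rule le_trans)
      show "x \<sqsubseteq> v" "v \<sqsubseteq> y" using that S T unfolding iffs by (auto simp: lless_eq)
    qed (use that S T assms in \<open>auto simp: iffs\<close>)
    then show "C \<in> lk (chains_in A) {v}"
      using S T assms unfolding C iffs by (auto simp: lless_eq)
  qed
qed

text \<open>The image of \<open>f\<close> has least element \<open>z\<close>, so its order complex
  is a cone. For a removed element \<open>b\<close>, extensivity makes \<open>f b\<close> comparable
  with what lies below \<open>b\<close>; monotonicity and idempotence do the same for closed
  elements above \<open>b\<close>.\<close>

lemma nonevasive_closure_operator:
  assumes fin: "finite A" and A: "A \<subseteq> carrier L"
    and f: "\<And>x. x \<in> A \<Longrightarrow> f x \<in> A"
    and ext: "\<And>x. x \<in> A \<Longrightarrow> x \<sqsubseteq> f x"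
    and mono: "\<And>x y. x \<in> A \<Longrightarrow> y \<in> A \<Longrightarrow> x \<sqsubseteq> y \<Longrightarrow> f x \<sqsubseteq> f y"
    and idem: "\<And>x. x \<in> A \<Longrightarrow> f (f x) = f x"
    and z: "z \<in> A" "f z = z" "\<And>x. x \<in> A \<Longrightarrow> z \<sqsubseteq> f x"
  shows "nonevasive (chains_in A)"
proof -
  \<comment> \<open>Generalised to every \<open>B\<close> between the closed elements and
    \<open>A\<close>, a range preserved by removing a non-closed element.\<close>
  have "nonevasive (chains_in B)" if "f ` A \<subseteq> B" "B \<subseteq> A" for B
    using that
  proof (induction "card B" arbitrary: B rule: less_induct)
    case less
    note B = less.prems
    have BL: "B \<subseteq> carrier L" using B(2) A by blast
    have finB: "finite B" using B(2) fin by (rule finite_subset)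
    show ?case
    proof (cases "B = f ` A")
      case True
      have zB: "z \<in> B" using True z by (metis imageI)
      show ?thesis
      proof (rule nonevasive_cone[where v = z])
        show "insert z C \<in> chains_in B" if "C \<in> chains_in B" for C
          using that zB z(3) BL True unfolding chains_in_iff[OF BL] by auto
      qed (use finB zB in \<open>simp_all add: simplicial_complex_chains_in vertices_chains_in[OF BL]\<close>)
    next
      case False
      \<comment> \<open>By maximality, every element of \<open>B\<close> strictly above
        \<open>b\<close> is closed.\<close>
      then obtain b where b: "b \<in> B - f ` A" "\<And>x. x \<in> B - f ` A \<Longrightarrow> b \<sqsubseteq> x \<Longrightarrow> x = b"
        using finite_has_maximal_in[of "B - f ` A"] finB B(1) BL by blast
      have bA: "b \<in> A" and bB: "b \<in> B" using b(1) B(2) by blast+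
      then have "f b \<in> f ` A" by blast
      then have fb: "f b \<in> B" "f b \<noteq> b" using b(1) B(1) by (blast, metis DiffD2)
      have b_le: "b \<sqsubseteq> f b" using bA by (rule ext)
      have comparable: "x \<sqsubseteq> f b \<or> f b \<sqsubseteq> x" if x: "x \<in> B" "x \<sqsubseteq> b \<or> b \<sqsubseteq> x" "x \<noteq> b" for x
        using x(2)
      proof
        assume "x \<sqsubseteq> b"
        then have "x \<sqsubseteq> f b" using b_le fb x(1) bB BL by (meson le_trans subsetD)
        then show ?thesis ..
      next
        assume "b \<sqsubseteq> x"
        \<comment> \<open>As \<open>x = f y\<close> is closed,
          \<open>f b \<sqsubseteq> f x = x\<close>.\<close>
        then obtain y where y: "y \<in> A" "x = f y" using b(2) x by blast
        then show ?thesis using mono[OF bA _ \<open>b \<sqsubseteq> x\<close>] idem f by simp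
      qed
      show ?thesis
      proof (rule nonevasive_delete[OF finB BL bB])
        show "nonevasive (chains_in (B - {b}))"
          using b(1) B finB bB by (intro less.hyps card_Diff1_less) auto
        note lkb = lk_iff[OF simplicial_complex_chains_in, where v = b] chains_in_iff[OF BL]
        show "nonevasive (lk (chains_in B) {b})"
        proof (rule nonevasive_cone[where v = "f b"])
          show "finite (vertices (lk (chains_in B) {b}))"
            by (rule finite_subset[OF vertices_lk_subset]) (simp add: vertices_chains_in BL finB)
          show "f b \<in> vertices (lk (chains_in B) {b})"
            using fb b_le bB BL unfolding vertices_def mem_Collect_eq lkb by auto
          show "insert (f b) C \<in> lk (chains_in B) {b}" if C: "C \<in> lk (chains_in B) {b}" for C
          proof -
            have "x \<sqsubseteq> f b \<or> f b \<sqsubseteq> x" if "x \<in> C" for x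
              using C that comparable[of x] unfolding lkb by blast
            then show ?thesis using C fb b_le bB BL unfolding lkb by auto
          qed
        qed (rule simplicial_complex_lk[OF simplicial_complex_chains_in])
      qed
    qed
  qed
  from this[of A] f show ?thesis by blast
qed

section \<open>Joins and meets of those pairs that have them\<close>

lemma join_exists_least: "join_exists L x y \<Longrightarrow> least L (x \<squnion> y) (Upper L {x, y})"
  unfolding join_exists_def join_def sup_def by (rule someI_ex)

lemma meet_exists_greatest: "meet_exists L x y \<Longrightarrow> greatest L (x \<sqinter> y) (Lower L {x, y})"
  unfolding meet_exists_def meet_def inf_def by (rule someI_ex)

lemma join_existsD:
  assumes "join_exists L x y" "x \<in> carrier L" "y \<in> carrier L"
  shows "x \<squnion> y \<in> carrier L" "x \<sqsubseteq> x \<squnion> y" "y \<sqsubseteq> x \<squnion> y"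
    and "\<And>u. u \<in> carrier L \<Longrightarrow> x \<sqsubseteq> u \<Longrightarrow> y \<sqsubseteq> u \<Longrightarrow> x \<squnion> y \<sqsubseteq> u"
  using join_exists_least[OF assms(1)] assms(2,3) unfolding least_def Upper_def by auto

lemma meet_existsD:
  assumes "meet_exists L x y" "x \<in> carrier L" "y \<in> carrier L"
  shows "x \<sqinter> y \<in> carrier L" "x \<sqinter> y \<sqsubseteq> x" "x \<sqinter> y \<sqsubseteq> y"
    and "\<And>u. u \<in> carrier L \<Longrightarrow> u \<sqsubseteq> x \<Longrightarrow> u \<sqsubseteq> y \<Longrightarrow> u \<sqsubseteq> x \<sqinter> y"
  using meet_exists_greatest[OF assms(1)] assms(2,3) unfolding greatest_def Lower_def by auto

text \<open>An explicit least upper bound certifies existence and, by antisymmetry, determines the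
  chosen value. This serves both to place elements in \<open>J\<close> and to compute their joins
  with \<open>s\<close>.\<close>

lemma join_equality:
  assumes "x \<in> carrier L" "y \<in> carrier L" "j \<in> carrier L" "x \<sqsubseteq> j" "y \<sqsubseteq> j"
    and "\<And>u. u \<in> carrier L \<Longrightarrow> x \<sqsubseteq> u \<Longrightarrow> y \<sqsubseteq> u \<Longrightarrow> j \<sqsubseteq> u"
  shows "join_exists L x y" "x \<squnion> y = j"
proof -
  have "least L j (Upper L {x, y})" using assms unfolding least_def Upper_def by auto
  then show je: "join_exists L x y" unfolding join_exists_def by blast
  show "x \<squnion> y = j"
    using join_existsD[OF je assms(1,2)] assms(3-6) by (meson le_antisym)
qed

end

theorem theorem14:
  fixes P :: "('a, 'm) gorder_scheme" and s :: 'a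
  assumes "partial_order P"
    and "finite (carrier P)"
    and "s \<in> carrier P"
    and "\<And>a. a \<in> carrier P \<Longrightarrow> join_exists P a s \<or> meet_exists P a s"
    and "\<And>a b. \<lbrakk>a \<in> carrier P; b \<in> carrier P; b \<sqsubset>\<^bsub>P\<^esub> a;
                \<not> join_exists P a s; join_exists P b s\<rbrakk>
               \<Longrightarrow> meet_exists P a (b \<squnion>\<^bsub>P\<^esub> s)"
  shows "nonevasive (order_complex P)"
proof -
  interpret partial_order P by fact
  note s = assms(3)
  define J where "J = {a \<in> carrier P. join_exists P a s}"
  have JP: "J \<subseteq> carrier P" by (auto simp: J_def)
  have join_in: "x \<squnion>\<^bsub>P\<^esub> s \<in> carrier P" and join_ge: "x \<sqsubseteq>\<^bsub>P\<^esub> x \<squnion>\<^bsub>P\<^esub> s" "s \<sqsubseteq>\<^bsub>P\<^esub> x \<squnion>\<^bsub>P\<^esub> s"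
    and join_le: "\<And>u. u \<in> carrier P \<Longrightarrow> x \<sqsubseteq>\<^bsub>P\<^esub> u \<Longrightarrow> s \<sqsubseteq>\<^bsub>P\<^esub> u \<Longrightarrow> x \<squnion>\<^bsub>P\<^esub> s \<sqsubseteq>\<^bsub>P\<^esub> u"
    if "x \<in> J" for x
    using that join_existsD[of x s] s by (auto simp: J_def)
  \<comment> \<open>An upper bound of \<open>y\<close> and \<open>s\<close> also bounds
    \<open>x\<close>, hence lies above the join of \<open>x\<close> and \<open>s\<close>, which
    itself bounds \<open>y\<close> and \<open>s\<close>. Both closure operators take their values in
    such intervals, so this yields membership in \<open>J\<close> and idempotence.\<close>
  have between: "y \<in> J \<and> y \<squnion>\<^bsub>P\<^esub> s = x \<squnion>\<^bsub>P\<^esub> s"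
    if "x \<in> J" "y \<in> carrier P" "x \<sqsubseteq>\<^bsub>P\<^esub> y" "y \<sqsubseteq>\<^bsub>P\<^esub> x \<squnion>\<^bsub>P\<^esub> s" for x y
  proof -
    have "x \<squnion>\<^bsub>P\<^esub> s \<sqsubseteq>\<^bsub>P\<^esub> u" if "u \<in> carrier P" "y \<sqsubseteq>\<^bsub>P\<^esub> u" "s \<sqsubseteq>\<^bsub>P\<^esub> u" for u
      using join_le[OF \<open>x \<in> J\<close> that(1) _ that(3)] that \<open>x \<in> J\<close> \<open>y \<in> carrier P\<close> \<open>x \<sqsubseteq>\<^bsub>P\<^esub> y\<close> JP
      by (meson le_trans subsetD)
    then show ?thesis
      using join_equality[of y s "x \<squnion>\<^bsub>P\<^esub> s"] that join_in join_ge s by (auto simp: J_def)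
  qed
  have below_s: "x \<in> J \<and> x \<squnion>\<^bsub>P\<^esub> s = s" if "x \<in> carrier P" "x \<sqsubseteq>\<^bsub>P\<^esub> s" for x
    using join_equality[of x s s] that s by (auto simp: J_def)
  have join_mono: "x \<squnion>\<^bsub>P\<^esub> s \<sqsubseteq>\<^bsub>P\<^esub> y \<squnion>\<^bsub>P\<^esub> s" if "x \<in> J" "y \<in> J" "x \<sqsubseteq>\<^bsub>P\<^esub> y" for x y
  proof (rule join_le[OF that(1) join_in[OF that(2)] _ join_ge(2)[OF that(2)]])
    show "x \<sqsubseteq>\<^bsub>P\<^esub> y \<squnion>\<^bsub>P\<^esub> s"
      using that join_ge(1)[OF that(2)] join_in[OF that(2)] JP by (meson le_trans subsetD)
  qed
  have J: "nonevasive (chains_in J)"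
  proof (rule nonevasive_closure_operator[where f = "\<lambda>x. x \<squnion>\<^bsub>P\<^esub> s" and z = s])
    show "finite J" using JP assms(2) by (rule finite_subset)
    show "x \<squnion>\<^bsub>P\<^esub> s \<in> J" "(x \<squnion>\<^bsub>P\<^esub> s) \<squnion>\<^bsub>P\<^esub> s = x \<squnion>\<^bsub>P\<^esub> s" if "x \<in> J" for x
      using between[of x "x \<squnion>\<^bsub>P\<^esub> s"] that join_in join_ge by auto
    show "s \<in> J" "s \<squnion>\<^bsub>P\<^esub> s = s" using below_s s by auto
  qed (use JP join_ge join_mono in auto)
  have J_below: "nonevasive (chains_in {x \<in> J. x \<sqsubset>\<^bsub>P\<^esub> a})" if a: "a \<in> carrier P" "a \<notin> J" for a
  proof -
    let ?B = "{x \<in> J. x \<sqsubset>\<^bsub>P\<^esub> a}"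
    let ?f = "\<lambda>x. a \<sqinter>\<^bsub>P\<^esub> (x \<squnion>\<^bsub>P\<^esub> s)"
    \<comment> \<open>Hypothesis (i) leaves only the meet, since
      \<open>a \<notin> J\<close>.\<close>
    have meet_s: "meet_exists P a s" using assms(4) a by (auto simp: J_def)
    note ms = meet_existsD[OF meet_s a(1) s]
    have meet_f: "meet_exists P a (x \<squnion>\<^bsub>P\<^esub> s)" if "x \<in> ?B" for x
      using assms(5)[of a x] that a by (auto simp: J_def)
    have mf: "?f x \<in> carrier P" "?f x \<sqsubseteq>\<^bsub>P\<^esub> a" "?f x \<sqsubseteq>\<^bsub>P\<^esub> x \<squnion>\<^bsub>P\<^esub> s"
      "\<And>u. u \<in> carrier P \<Longrightarrow> u \<sqsubseteq>\<^bsub>P\<^esub> a \<Longrightarrow> u \<sqsubseteq>\<^bsub>P\<^esub> x \<squnion>\<^bsub>P\<^esub> s \<Longrightarrow> u \<sqsubseteq>\<^bsub>P\<^esub> ?f x" if "x \<in> ?B" for x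
      using meet_existsD[OF meet_f[OF that] a(1) join_in] that by auto
    have ext: "x \<sqsubseteq>\<^bsub>P\<^esub> ?f x" if "x \<in> ?B" for x
      using mf(4)[OF that] that join_ge JP by (auto simp: lless_eq)
    have fJ: "?f x \<in> J" "?f x \<squnion>\<^bsub>P\<^esub> s = x \<squnion>\<^bsub>P\<^esub> s" if "x \<in> ?B" for x
      using between[OF _ mf(1)[OF that] ext[OF that] mf(3)[OF that]] that by auto
    \<comment> \<open>Strictness: \<open>?f x\<close> lies in \<open>J\<close> and \<open>a\<close>
      does not, so they differ.\<close>
    have fB: "?f x \<in> ?B" if "x \<in> ?B" for x
      using fJ(1)[OF that] mf(2)[OF that] a(2) by (auto simp: lless_eq)
    \<comment> \<open>The join with \<open>s\<close> collapses to \<open>s\<close>, so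
      \<open>?f\<close> fixes the meet of \<open>a\<close> and \<open>s\<close>.\<close>
    have z: "a \<sqinter>\<^bsub>P\<^esub> s \<in> J" "(a \<sqinter>\<^bsub>P\<^esub> s) \<squnion>\<^bsub>P\<^esub> s = s" using below_s ms by auto
    show ?thesis
    proof (rule nonevasive_closure_operator[where f = ?f and z = "a \<sqinter>\<^bsub>P\<^esub> s"])
      show "finite ?B" using JP assms(2) by (auto intro: finite_subset)
      show "?B \<subseteq> carrier P" using JP by auto
      show "?f x \<sqsubseteq>\<^bsub>P\<^esub> ?f y" if "x \<in> ?B" "y \<in> ?B" "x \<sqsubseteq>\<^bsub>P\<^esub> y" for x y
      proof (rule mf(4)[OF that(2) mf(1,2)[OF that(1)]])
        show "?f x \<sqsubseteq>\<^bsub>P\<^esub> y \<squnion>\<^bsub>P\<^esub> s"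
          by (rule le_trans[OF mf(3)[OF that(1)] join_mono])
            (use that mf(1)[OF that(1)] join_in in simp_all)
      qed
      show "?f (?f x) = ?f x" if "x \<in> ?B" for x using fJ(2)[OF that] by simp
      show "a \<sqinter>\<^bsub>P\<^esub> s \<in> ?B" using z(1) ms(2) a(2) by (auto simp: lless_eq)
      show "?f (a \<sqinter>\<^bsub>P\<^esub> s) = a \<sqinter>\<^bsub>P\<^esub> s" using z(2) by simp
      show "a \<sqinter>\<^bsub>P\<^esub> s \<sqsubseteq>\<^bsub>P\<^esub> ?f x" if "x \<in> ?B" for x
      proof (rule mf(4)[OF that ms(1,2)])
        show "a \<sqinter>\<^bsub>P\<^esub> s \<sqsubseteq>\<^bsub>P\<^esub> x \<squnion>\<^bsub>P\<^esub> s"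
          by (rule le_trans[OF ms(3) join_ge(2)]) (use that ms(1) s join_in in simp_all)
      qed
    qed (use ext fB in blast)+
  qed
  \<comment> \<open>Induction on the size of \<open>R\<close>, starting from \<open>J\<close> and
    ending at the whole carrier.\<close>
  have "nonevasive (chains_in R)" if "J \<subseteq> R" "R \<subseteq> carrier P" for R
    using that
  proof (induction "card R" arbitrary: R rule: less_induct)
    case less
    note R = less.prems
    have finR: "finite R" using R(2) assms(2) by (rule finite_subset)
    show ?case
    proof (cases "R = J")
      case True
      then show ?thesis using J by simp
    next
      case False
      then obtain a where a: "a \<in> R - J" "\<And>x. x \<in> R - J \<Longrightarrow> x \<sqsubseteq>\<^bsub>P\<^esub> a \<Longrightarrow> x = a"
        using finite_has_minimal_in[of "R - J"] finR R by blast
      have below: "{x \<in> R. x \<sqsubset>\<^bsub>P\<^esub> a} = {x \<in> J. x \<sqsubset>\<^bsub>P\<^esub> a}"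
        using a(2) R(1) by (auto simp: lless_eq)
      show ?thesis
      proof (rule nonevasive_delete[OF finR R(2)])
        show "a \<in> R" using a(1) by blast
        then show "nonevasive (chains_in (R - {a}))"
          using a(1) R finR by (intro less.hyps card_Diff1_less) auto
        let ?U = "{x \<in> R. a \<sqsubset>\<^bsub>P\<^esub> x}"
        have U: "?U \<subseteq> carrier P" using R(2) by blast
        have B: "{x \<in> J. x \<sqsubset>\<^bsub>P\<^esub> a} \<subseteq> carrier P" using JP by blast
        show "nonevasive (lk (chains_in R) {a})"
          unfolding lk_chains_in[OF R(2) \<open>a \<in> R\<close>] below
        \<comment> \<open>The part below \<open>a\<close> is the non-evasive factor; the part above
          is the arbitrary one. Antisymmetry makes them disjoint.\<close>
        proof (rule nonevasive_join_complex)
          show "nonevasive (chains_in {x \<in> J. x \<sqsubset>\<^bsub>P\<^esub> a})" using J_below a(1) R(2) by blast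
          show "{} \<in> chains_in ?U" by (simp add: chains_in_iff[OF U])
          show "finite (vertices (chains_in ?U))" using finR by (simp add: vertices_chains_in[OF U])
          show "vertices (chains_in {x \<in> J. x \<sqsubset>\<^bsub>P\<^esub> a}) \<inter> vertices (chains_in ?U) = {}"
            unfolding vertices_chains_in[OF U] vertices_chains_in[OF B]
            using JP a(1) R(2) by (auto simp: lless_eq)
        qed (rule simplicial_complex_chains_in)
      qed
    qed
  qed
  from this[OF JP order_refl] have "nonevasive (chains_in (carrier P))" .
  moreover have "chains_in (carrier P) = order_complex P"
    by (auto simp: restriction_def order_complex_def)
  ultimately show ?thesis by simp
qed

end
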